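(* Let $d\ge2$, let $A\neq0$ be an essential $k\times k$ binary matrix, let $M=\max_i\sum_jA_{i,j}$ be its maximal row sum, and let $\mathcal{T}_A$ be the hom Markov tree-shift on the $d$-tree induced by $A$. (i) If $M=1$, then $h(\mathcal{T}_A)=0$. (ii) If $M\ge2$, then $h(\mathcal{T}_A)\ge\frac{d-1}{d}\log M\ge\frac12\log2$.
   Context: A binary matrix (entries in $\{0,1\}$) is essential if it has no zero rows and no zero columns. The rows and columns of $A$ are indexed by $\mathcal{A}=\{1,\dots,k\}$. Let $\Sigma=\{0,1,\dots,d-1\}$, $\Sigma^*=\bigcup_{n\ge0}\Sigma^n$ the set of all finite words over $\Sigma$, and $\Delta_n=\bigcup_{i=0}^n\Sigma^i$. A labeled tree is a function $t:\Sigma^*\to\mathcal{A}$, $w\mapsto t_w$. An $n$-block is a function $u:\Delta_n\to\mathcal{A}$; it appears in $t$ if there is $s\in\Sigma^*$ with $t_{sw}=u_w$ for all $w\in\Delta_n$. Then $\mathcal{T}_A=\{t\in\mathcal{A}^{\Sigma^*}: A_{t_w,t_{wi}}=1\ \forall w\in\Sigma^*, i\in\Sigma\}$, $B_n(\mathcal{T}_A)$ is the set of $n$-blocks appearing in elements of $\mathcal{T}_A$, and the topological entropy is $h(\mathcal{T}_A)=\lim_{n\to\infty}\frac{\log|B_n(\mathcal{T}_A)|}{|\Delta_n|}$ (the limit is known to exist). *)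

theory Defs
  imports "HOL-Analysis.Analysis"
begin

text \<open>
  The alphabet of directions \<open>{0, \<dots>, d - 1}\<close> is represented by a finite type \<open>'d\<close> with
  \<open>d = CARD('d)\<close>, the index set \<open>{1, \<dots>, k}\<close> of the matrix (which is also the set of labels) by a
  finite type \<open>'k\<close> with \<open>k = CARD('k)\<close>. Finite words over the directions are lists.
\<close>

definition binary_matrix :: "nat ^ 'n ^ 'm \<Rightarrow> bool" where
  "binary_matrix A \<longleftrightarrow> (\<forall>i j. A $ i $ j \<in> {0, 1})"

definition essential_matrix :: "nat ^ 'n ^ 'm \<Rightarrow> bool" where
  "essential_matrix A \<longleftrightarrow> (\<forall>i. row i A \<noteq> 0) \<and> (\<forall>j. column j A \<noteq> 0)"

definition max_row_sum :: "nat ^ 'n ^ 'm \<Rightarrow> nat" where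
  "max_row_sum A = (MAX i. \<Sum>j\<in>UNIV. A $ i $ j)"

type_synonym ('d, 'k) labeled_tree = "'d list \<Rightarrow> 'k"

definition Delta :: "nat \<Rightarrow> 'd list set" where
  "Delta n = {w. length w \<le> n}"

text \<open>
  An \<open>n\<close>-block is a function on \<^term>\<open>Delta n\<close>, encoded as a function that is
  \<^const>\<open>undefined\<close> outside \<^term>\<open>Delta n\<close>, so that counting encodings counts blocks.
\<close>

definition n_blocks :: "nat \<Rightarrow> ('d list \<Rightarrow> 'k) set" where
  "n_blocks n = Delta n \<rightarrow>\<^sub>E UNIV"

definition appears_in :: "nat \<Rightarrow> ('d list \<Rightarrow> 'k) \<Rightarrow> ('d, 'k) labeled_tree \<Rightarrow> bool" where
  "appears_in n u t \<longleftrightarrow> (\<exists>s. \<forall>w\<in>Delta n. t (s @ w) = u w)"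

definition blocks_of :: "nat \<Rightarrow> ('d, 'k) labeled_tree set \<Rightarrow> ('d list \<Rightarrow> 'k) set" where
  "blocks_of n T = {u \<in> n_blocks n. \<exists>t\<in>T. appears_in n u t}"

definition markov_tree_shift :: "nat ^ 'k ^ 'k \<Rightarrow> ('d, 'k) labeled_tree set" where
  "markov_tree_shift A = {t. \<forall>w i. A $ t w $ t (w @ [i]) = 1}"

definition entropy :: "('d::finite, 'k::finite) labeled_tree set \<Rightarrow> real" where
  "entropy T =
    lim (\<lambda>n. ln (real (card (blocks_of n T))) / real (card (Delta n :: 'd list set)))"

end

theory Submission
  imports Defs
begin

text \<open>
  Call an \<open>n\<close>-block admissible if every edge of \<^term>\<open>Delta n\<close> carries an allowed
  transition. Since no row of \<open>A\<close> vanishes, an admissible block can be continued downwards for ever,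
  so the blocks of the tree-shift are exactly the admissible ones
  (\<open>blocks_of_markov_tree_shift\<close>). Let \<open>x\<^sub>n(i)\<close> be the number of admissible \<open>n\<close>-blocks with
  root label \<open>i\<close>. A block of height \<open>n + 1\<close> consists of its root and \<open>d\<close> independently chosen
  subtrees of height \<open>n\<close>, which gives the recursion
  \<open>x\<^sub>n\<^sub>+\<^sub>1(i) = (\<Sum>j. A\<^sub>i\<^sub>j x\<^sub>n(j))\<^sup>d\<close> (\<open>card_rooted_blocks_Suc\<close>). Everything else is read off from
  it.

  Write \<open>b\<^sub>n = ln |B\<^sub>n|\<close>. The recursion gives \<open>|B\<^sub>n\<^sub>+\<^sub>1| \<le> k |B\<^sub>n|\<^sup>d\<close>, hence
  \<open>b\<^sub>n\<^sub>+\<^sub>1 \<le> ln k + d b\<^sub>n\<close>, and so \<open>b\<^sub>n / d\<^sup>n\<close> is, up to a vanishing correction,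
  decreasing and bounded below: it converges to some \<open>c\<close>. As \<open>|Delta n| / d\<^sup>n\<close> tends to
  \<open>d / (d - 1)\<close>, the entropy is \<open>c (d - 1) / d\<close> (\<open>entropy_eqI\<close>).

  If \<open>M = 1\<close>, each label has a single successor, the root determines the whole block, and
  \<open>|B\<^sub>n|\<close> is the constant \<open>k\<close>, whence \<open>c = 0\<close>. For the lower bound, choose a label \<open>i\<close> with
  \<open>M\<close> successors. No column of \<open>A\<close> vanishes, so some path of length \<open>n - 1\<close> ends in \<open>i\<close>; labeling
  each level of the tree by the corresponding vertex of this path puts \<open>i\<close> on all of level
  \<open>n - 1\<close>, and the \<open>d\<^sup>n\<close> nodes of level \<open>n\<close> may then be labeled independently in \<open>M\<close> ways each.
  Thus \<open>|B\<^sub>n| \<ge> M ^ (d ^ n)\<close> (\<open>power_le_card_blocks_of\<close>), that is \<open>c \<ge> ln M\<close>: the last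
  level alone, which makes up the fraction \<open>(d - 1) / d\<close> of the tree asymptotically, produces
  this much entropy.
\<close>

section \<open>Admissible blocks\<close>

definition successors :: "nat ^ 'k ^ 'k \<Rightarrow> 'k \<Rightarrow> 'k set" where
  "successors A i = {j. A $ i $ j = 1}"

definition rooted_blocks :: "nat ^ 'k ^ 'k \<Rightarrow> nat \<Rightarrow> 'k \<Rightarrow> ('d list \<Rightarrow> 'k) set" where
  "rooted_blocks A n i = {u \<in> n_blocks n. u [] = i \<and>
     (\<forall>w c. length w < n \<longrightarrow> u (w @ [c]) \<in> successors A (u w))}"

lemma essential_successor:
  assumes "binary_matrix A" and "essential_matrix A"
  shows "\<exists>j. j \<in> successors A i"
proof -
  have "row i A \<noteq> 0" using assms(2) by (simp add: essential_matrix_def)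
  then obtain j where "A $ i $ j \<noteq> 0" by (auto simp: row_def vec_eq_iff)
  moreover have "A $ i $ j \<in> {0, 1}" using assms(1) unfolding binary_matrix_def by blast
  ultimately have "A $ i $ j = 1" by simp
  then show ?thesis by (auto simp: successors_def)
qed

lemma essential_predecessor:
  assumes "binary_matrix A" and "essential_matrix A"
  shows "\<exists>i. j \<in> successors A i"
proof -
  have "column j A \<noteq> 0" using assms(2) by (simp add: essential_matrix_def)
  then obtain i where "A $ i $ j \<noteq> 0" by (auto simp: column_def vec_eq_iff)
  moreover have "A $ i $ j \<in> {0, 1}" using assms(1) unfolding binary_matrix_def by blast
  ultimately have "A $ i $ j = 1" by simp
  then show ?thesis by (auto simp: successors_def)
qed

lemma row_sum_eq_card_successors:
  assumes "binary_matrix A"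
  shows "(\<Sum>j\<in>UNIV. A $ i $ j) = card (successors A i)"
proof -
  have "A $ i $ j = of_bool (j \<in> successors A i)" for j
    using assms by (auto simp: binary_matrix_def successors_def)
  then have "(\<Sum>j\<in>UNIV. A $ i $ j) = (\<Sum>j\<in>UNIV. of_bool (j \<in> successors A i))"
    by simp
  then show ?thesis by simp
qed

lemma max_row_sum_eq_Max_card:
  assumes "binary_matrix A"
  shows "max_row_sum A = (MAX i. card (successors A i))"
  by (simp add: max_row_sum_def row_sum_eq_card_successors[OF assms])

lemma finite_Delta: "finite (Delta n :: 'd::finite list set)"
  using finite_lists_length_le[of "UNIV :: 'd set" n] by (simp add: Delta_def)

lemma finite_n_blocks: "finite (n_blocks n :: ('d::finite list \<Rightarrow> 'k::finite) set)"
  by (simp add: n_blocks_def finite_PiE finite_Delta)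

lemma finite_rooted_blocks:
  "finite (rooted_blocks A n i :: ('d::finite list \<Rightarrow> 'k::finite) set)"
  by (rule finite_subset[OF _ finite_n_blocks[of n]]) (auto simp: rooted_blocks_def)

text \<open>
  An admissible block extends to a full tree: below level \<open>n\<close>, keep applying a fixed choice
  \<open>f\<close> of successor to the label met on level \<open>n\<close>.
\<close>

lemma rooted_block_extends:
  fixes u :: "'d list \<Rightarrow> 'k::finite"
  assumes "binary_matrix A" and "essential_matrix A" and u: "u \<in> rooted_blocks A n i"
  obtains t where "t \<in> markov_tree_shift A" and "\<And>w. length w \<le> n \<Longrightarrow> t w = u w"
proof -
  obtain f where f: "\<And>i. f i \<in> successors A i"
    using essential_successor[OF assms(1,2)] by metis
  define t where "t w = (f ^^ (length w - n)) (u (take n w))" for w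
  have "t (w @ [c]) \<in> successors A (t w)" for w c
  proof (cases "length w < n")
    case True
    then show ?thesis using u by (simp add: t_def rooted_blocks_def)
  next
    case False
    then have "t (w @ [c]) = f (t w)" by (simp add: t_def Suc_diff_le)
    then show ?thesis by (simp add: f)
  qed
  then have "t \<in> markov_tree_shift A" by (simp add: markov_tree_shift_def successors_def)
  moreover have "t w = u w" if "length w \<le> n" for w using that by (simp add: t_def)
  ultimately show ?thesis by (rule that)
qed

lemma blocks_of_markov_tree_shift:
  fixes A :: "nat ^ 'k ^ 'k"
  assumes "binary_matrix A" and "essential_matrix A"
  shows "blocks_of n (markov_tree_shift A :: ('d, 'k) labeled_tree set) = (\<Union>i. rooted_blocks A n i)"
proof (intro equalityI subsetI)
  fix u :: "'d list \<Rightarrow> 'k"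
  assume "u \<in> blocks_of n (markov_tree_shift A)"
  then obtain t s where u: "u \<in> n_blocks n" and t: "t \<in> markov_tree_shift A"
    and s: "\<And>w. length w \<le> n \<Longrightarrow> t (s @ w) = u w"
    by (auto simp: blocks_of_def appears_in_def Delta_def)
  have "u (w @ [c]) \<in> successors A (u w)" if "length w < n" for w c
  proof -
    have "t ((s @ w) @ [c]) \<in> successors A (t (s @ w))"
      using t unfolding markov_tree_shift_def successors_def by blast
    then show ?thesis using s[of w] s[of "w @ [c]"] that by simp
  qed
  with u show "u \<in> (\<Union>i. rooted_blocks A n i)" by (auto simp: rooted_blocks_def)
next
  fix u :: "'d list \<Rightarrow> 'k"
  assume "u \<in> (\<Union>i. rooted_blocks A n i)"
  then obtain i where u: "u \<in> rooted_blocks A n i" by blast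
  obtain t where "t \<in> markov_tree_shift A" and "\<And>w. length w \<le> n \<Longrightarrow> t w = u w"
    using rooted_block_extends[OF assms u] by blast
  then have "t \<in> markov_tree_shift A \<and> appears_in n u t"
    unfolding appears_in_def Delta_def by (auto intro!: exI[of _ "[]"])
  with u show "u \<in> blocks_of n (markov_tree_shift A)"
    by (auto simp: blocks_of_def rooted_blocks_def)
qed

lemma card_blocks_of_markov_tree_shift:
  fixes A :: "nat ^ 'k ^ 'k"
  assumes "binary_matrix A" and "essential_matrix A"
  shows "card (blocks_of n (markov_tree_shift A :: ('d::finite, 'k) labeled_tree set)) =
    (\<Sum>i\<in>UNIV. card (rooted_blocks A n i :: ('d list \<Rightarrow> 'k) set))"
  unfolding blocks_of_markov_tree_shift[OF assms]
  by (rule card_UN_disjoint) (simp_all add: finite_rooted_blocks, auto simp: rooted_blocks_def)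

section \<open>The recursion for the number of admissible blocks\<close>

lemma card_rooted_blocks_0: "card (rooted_blocks A 0 i :: ('d list \<Rightarrow> 'k::finite) set) = 1"
proof -
  have "rooted_blocks A 0 i = {\<lambda>w :: 'd list. if w = [] then i else undefined}"
    by (auto simp: rooted_blocks_def n_blocks_def Delta_def PiE_def extensional_def)
  then show ?thesis by simp
qed

text \<open>
  Once the root label is given, admissibility only constrains the labels of its children and each
  of the \<open>d\<close> subtrees separately, so the subtrees may be chosen independently of one another. The
  inverse map grafts a family of subtrees onto a root labeled \<open>i\<close>.
\<close>

lemma bij_betw_subtrees:
  fixes A :: "nat ^ 'k ^ 'k"
  shows "bij_betw (\<lambda>u c. \<lambda>w\<in>Delta n. u (c # w))
    (rooted_blocks A (Suc n) i :: ('d list \<Rightarrow> 'k) set)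
    (UNIV \<rightarrow>\<^sub>E (\<Union>j\<in>successors A i. rooted_blocks A n j))"
proof (rule bij_betwI)
  let ?graft = "\<lambda>v. \<lambda>w\<in>Delta (Suc n). case w of [] \<Rightarrow> i | c # w' \<Rightarrow> v c w'"
    and ?B = "rooted_blocks A (Suc n) i :: ('d list \<Rightarrow> 'k) set"
    and ?F = "UNIV \<rightarrow>\<^sub>E (\<Union>j\<in>successors A i. rooted_blocks A n j) :: ('d \<Rightarrow> 'd list \<Rightarrow> 'k) set"
  show "(\<lambda>u c. \<lambda>w\<in>Delta n. u (c # w)) \<in> ?B \<rightarrow> ?F"
  proof (intro Pi_I PiE_I)
    fix u :: "'d list \<Rightarrow> 'k" and c
    assume u: "u \<in> ?B"
    have edge: "u (w @ [c]) \<in> successors A (u w)" if "length w < Suc n" for w c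
      using u that by (simp add: rooted_blocks_def)
    have "u [c] \<in> successors A i" using edge[of "[]" c] u by (simp add: rooted_blocks_def)
    moreover have "(\<lambda>w\<in>Delta n. u (c # w)) \<in> rooted_blocks A n (u [c])"
      using edge[of "c # w" for w] by (auto simp: rooted_blocks_def n_blocks_def Delta_def)
    ultimately show "(\<lambda>w\<in>Delta n. u (c # w)) \<in> (\<Union>j\<in>successors A i. rooted_blocks A n j)"
      by blast
  qed simp
  show "?graft \<in> ?F \<rightarrow> ?B"
  proof
    fix v :: "'d \<Rightarrow> 'd list \<Rightarrow> 'k"
    assume "v \<in> ?F"
    then have v: "v c [] \<in> successors A i" "length w < n \<Longrightarrow> v c (w @ [c']) \<in> successors A (v c w)"
      for c w c'
      by (auto simp: PiE_iff rooted_blocks_def)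
    have "?graft v (w @ [c]) \<in> successors A (?graft v w)" if "length w < Suc n" for w c
      using that v by (cases w) (auto simp: Delta_def)
    then show "?graft v \<in> ?B"
      by (auto simp: rooted_blocks_def n_blocks_def Delta_def)
  qed
  show "?graft (\<lambda>c. \<lambda>w\<in>Delta n. u (c # w)) = u" if "u \<in> ?B" for u
    using that
    by (auto simp: rooted_blocks_def n_blocks_def Delta_def PiE_def extensional_def fun_eq_iff
        split: list.split)
  show "(\<lambda>c. \<lambda>w\<in>Delta n. ?graft v (c # w)) = v" if v: "v \<in> ?F" for v
  proof (intro ext)
    fix c w
    obtain j where "v c \<in> rooted_blocks A n j" using PiE_mem[OF v, of c] by auto
    then show "(\<lambda>w\<in>Delta n. ?graft v (c # w)) w = v c w"
      by (auto simp: rooted_blocks_def n_blocks_def Delta_def PiE_def extensional_def)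
  qed
qed

lemma card_rooted_blocks_Suc:
  fixes A :: "nat ^ 'k ^ 'k"
  shows "card (rooted_blocks A (Suc n) i :: ('d::finite list \<Rightarrow> 'k) set) =
    (\<Sum>j\<in>successors A i. card (rooted_blocks A n j :: ('d list \<Rightarrow> 'k) set)) ^ CARD('d)"
proof -
  have "card (\<Union>j\<in>successors A i. rooted_blocks A n j :: ('d list \<Rightarrow> 'k) set) =
      (\<Sum>j\<in>successors A i. card (rooted_blocks A n j :: ('d list \<Rightarrow> 'k) set))"
    by (rule card_UN_disjoint) (simp_all add: finite_rooted_blocks, auto simp: rooted_blocks_def)
  then show ?thesis
    using bij_betw_same_card[OF bij_betw_subtrees[of n A i, where 'd = 'd]]
    by (simp add: card_PiE)
qed

section \<open>Bounds for the number of blocks\<close>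

text \<open>
  The base \<open>n = 1\<close> is a root with \<open>M\<close> successors; putting a predecessor of the root label above
  \<open>d\<close> copies of the root raises the count to the power \<open>d\<close>.
\<close>

lemma power_le_card_rooted_blocks:
  fixes A :: "nat ^ 'k ^ 'k"
  assumes "binary_matrix A" and "essential_matrix A"
  shows "\<exists>i. max_row_sum A ^ (CARD('d) ^ Suc n) \<le>
    card (rooted_blocks A (Suc n) i :: ('d::finite list \<Rightarrow> 'k) set)"
proof (induction n)
  case 0
  have "max_row_sum A \<in> range (\<lambda>i. card (successors A i))"
    unfolding max_row_sum_eq_Max_card[OF assms(1)] by (rule Max_in) auto
  then obtain i where "max_row_sum A = card (successors A i)" by blast
  then show ?case by (auto simp: card_rooted_blocks_Suc card_rooted_blocks_0 intro!: exI[of _ i])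
next
  case (Suc n)
  then obtain j where j: "max_row_sum A ^ (CARD('d) ^ Suc n) \<le>
      card (rooted_blocks A (Suc n) j :: ('d list \<Rightarrow> 'k) set)" by blast
  obtain i where i: "j \<in> successors A i" using essential_predecessor[OF assms] by blast
  have "max_row_sum A ^ (CARD('d) ^ Suc (Suc n)) = (max_row_sum A ^ (CARD('d) ^ Suc n)) ^ CARD('d)"
    by (simp add: power_mult[symmetric] mult.commute)
  also have "\<dots> \<le> card (rooted_blocks A (Suc n) j :: ('d list \<Rightarrow> 'k) set) ^ CARD('d)"
    using j by (rule power_mono) simp
  also have "\<dots> \<le> card (rooted_blocks A (Suc (Suc n)) i :: ('d list \<Rightarrow> 'k) set)"
    unfolding card_rooted_blocks_Suc[of A "Suc n" i]
    using i by (intro power_mono member_le_sum) auto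
  finally show ?case by blast
qed

lemma power_le_card_blocks_of:
  fixes A :: "nat ^ 'k ^ 'k"
  assumes "binary_matrix A" and "essential_matrix A" and "n \<ge> 1"
  shows "max_row_sum A ^ (CARD('d) ^ n) \<le>
    card (blocks_of n (markov_tree_shift A :: ('d::finite, 'k) labeled_tree set))"
proof -
  obtain m where n: "n = Suc m" using assms(3) by (cases n) auto
  obtain i where "max_row_sum A ^ (CARD('d) ^ n) \<le>
      card (rooted_blocks A n i :: ('d list \<Rightarrow> 'k) set)"
    using power_le_card_rooted_blocks[OF assms(1,2)] unfolding n by blast
  also have "\<dots> \<le> (\<Sum>i\<in>UNIV. card (rooted_blocks A n i :: ('d list \<Rightarrow> 'k) set))"
    by (rule member_le_sum) auto
  finally show ?thesis by (simp add: card_blocks_of_markov_tree_shift[OF assms(1,2)])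
qed

lemma card_blocks_of_Suc_le:
  fixes A :: "nat ^ 'k ^ 'k"
  assumes "binary_matrix A" and "essential_matrix A"
  shows "card (blocks_of (Suc n) (markov_tree_shift A :: ('d::finite, 'k) labeled_tree set)) \<le>
    CARD('k) * card (blocks_of n (markov_tree_shift A :: ('d, 'k) labeled_tree set)) ^ CARD('d)"
proof -
  let ?x = "\<lambda>n i. card (rooted_blocks A n i :: ('d list \<Rightarrow> 'k) set)"
  have "(\<Sum>i\<in>UNIV. ?x (Suc n) i) \<le> (\<Sum>i\<in>(UNIV :: 'k set). (\<Sum>j\<in>UNIV. ?x n j) ^ CARD('d))"
    unfolding card_rooted_blocks_Suc by (intro sum_mono power_mono sum_mono2) auto
  then show ?thesis by (simp add: card_blocks_of_markov_tree_shift[OF assms])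
qed

lemma card_rooted_blocks_deterministic:
  assumes "\<And>i. card (successors A i) = 1"
  shows "card (rooted_blocks A n i :: ('d::finite list \<Rightarrow> 'k::finite) set) = 1"
  by (induction n arbitrary: i) (simp_all add: card_rooted_blocks_0 card_rooted_blocks_Suc assms)

lemma card_blocks_of_deterministic:
  fixes A :: "nat ^ 'k ^ 'k"
  assumes "binary_matrix A" and "essential_matrix A" and "max_row_sum A = 1"
  shows "card (blocks_of n (markov_tree_shift A :: ('d::finite, 'k) labeled_tree set)) = CARD('k)"
proof -
  have "card (successors A i) = 1" for i
  proof -
    have "card (successors A i) \<le> 1"
      using assms(3) unfolding max_row_sum_eq_Max_card[OF assms(1)]
      by (metis Max_ge finite finite_imageI rangeI)
    moreover have "card (successors A i) > 0"
      using essential_successor[OF assms(1,2)] by (auto simp: card_gt_0_iff)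
    ultimately show ?thesis by linarith
  qed
  then show ?thesis
    by (simp add: card_blocks_of_markov_tree_shift[OF assms(1,2)] card_rooted_blocks_deterministic)
qed

section \<open>Entropy as a limit normalized by the size of the last level\<close>

text \<open>
  With \<open>K = C / (d - 1)\<close>, the solution of \<open>C + K = d K\<close>, the sequence \<open>(b n + K) / d ^ n\<close> is
  decreasing.
\<close>

lemma convergent_over_power:
  fixes b :: "nat \<Rightarrow> real"
  assumes "d > 1" and "C \<ge> 0" and nonneg: "\<And>n. b n \<ge> 0" and step: "\<And>n. b (Suc n) \<le> C + d * b n"
  shows "convergent (\<lambda>n. b n / d ^ n)"
proof -
  define K where "K = C / (d - 1)"
  have K: "C + K = d * K" "K \<ge> 0" using assms(1,2) by (simp_all add: K_def field_simps)
  have "decseq (\<lambda>n. (b n + K) / d ^ n)"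
  proof (rule decseq_SucI)
    fix n
    have "(b (Suc n) + K) / d ^ Suc n \<le> (d * (b n + K)) / d ^ Suc n"
      using step[of n] K(1) assms(1) by (intro divide_right_mono) (simp_all add: algebra_simps)
    then show "(b (Suc n) + K) / d ^ Suc n \<le> (b n + K) / d ^ n" using assms(1) by simp
  qed
  moreover have "0 \<le> (b n + K) / d ^ n" for n using nonneg[of n] K(2) assms(1) by simp
  ultimately obtain c where "(\<lambda>n. (b n + K) / d ^ n) \<longlonglongrightarrow> c"
    using decseq_convergent by blast
  moreover have "(\<lambda>n. K / d ^ n) \<longlonglongrightarrow> 0" using assms(1) by (rule LIMSEQ_divide_realpow_zero)
  ultimately have "(\<lambda>n. (b n + K) / d ^ n - K / d ^ n) \<longlonglongrightarrow> c - 0" by (rule tendsto_diff)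
  then show ?thesis by (auto simp: add_divide_distrib convergent_def)
qed

lemma card_Delta:
  assumes "CARD('d::finite) \<ge> 2"
  shows "real (card (Delta n :: 'd list set)) = (real CARD('d) ^ Suc n - 1) / (real CARD('d) - 1)"
proof -
  have "card (Delta n :: 'd list set) = (\<Sum>i\<le>n. CARD('d) ^ i)"
    using card_lists_length_le[of "UNIV :: 'd set" n] by (simp add: Delta_def)
  then have "real (card (Delta n :: 'd list set)) = (\<Sum>i<Suc n. real CARD('d) ^ i)"
    by (simp add: lessThan_Suc_atMost)
  also have "\<dots> = (real CARD('d) ^ Suc n - 1) / (real CARD('d) - 1)"
    using assms by (intro geometric_sum) simp
  finally show ?thesis .
qed

lemma card_Delta_over_power_tendsto:
  assumes "CARD('d::finite) \<ge> 2"
  shows "(\<lambda>n. real (card (Delta n :: 'd list set)) / real CARD('d) ^ n)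
    \<longlonglongrightarrow> real CARD('d) / (real CARD('d) - 1)"
proof -
  let ?d = "real CARD('d)"
  have "(\<lambda>n. 1 / ?d ^ n) \<longlonglongrightarrow> 0" using assms by (intro LIMSEQ_divide_realpow_zero) simp
  then have "(\<lambda>n. (?d - 1 / ?d ^ n) / (?d - 1)) \<longlonglongrightarrow> (?d - 0) / (?d - 1)"
    using assms by (intro tendsto_intros) auto
  moreover have "real (card (Delta n :: 'd list set)) / ?d ^ n = (?d - 1 / ?d ^ n) / (?d - 1)" for n
    using assms by (simp add: card_Delta field_simps)
  ultimately show ?thesis by simp
qed

lemma entropy_eqI:
  fixes T :: "('d::finite, 'k::finite) labeled_tree set"
  assumes "CARD('d) \<ge> 2"
    and "(\<lambda>n. ln (real (card (blocks_of n T))) / real CARD('d) ^ n) \<longlonglongrightarrow> c"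
  shows "entropy T = (real CARD('d) - 1) / real CARD('d) * c"
proof -
  let ?d = "real CARD('d)"
  have "(\<lambda>n. (ln (real (card (blocks_of n T))) / ?d ^ n) /
      (real (card (Delta n :: 'd list set)) / ?d ^ n)) \<longlonglongrightarrow> c / (?d / (?d - 1))"
    using assms(1) by (intro tendsto_divide assms(2) card_Delta_over_power_tendsto) auto
  then have "(\<lambda>n. ln (real (card (blocks_of n T))) / real (card (Delta n :: 'd list set)))
      \<longlonglongrightarrow> (?d - 1) / ?d * c"
    by (simp add: mult.commute)
  then show ?thesis unfolding entropy_def by (rule limI)
qed

section \<open>Entropy of Markov tree-shifts\<close>

lemma convergent_ln_card_blocks_of:
  fixes A :: "nat ^ 'k ^ 'k"
  assumes "CARD('d::finite) \<ge> 2" and "binary_matrix A" and "essential_matrix A"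
  shows "convergent (\<lambda>n. ln (real (card (blocks_of n
    (markov_tree_shift A :: ('d, 'k) labeled_tree set)))) / real CARD('d) ^ n)"
proof (rule convergent_over_power[where C = "ln (real CARD('k))"])
  let ?B = "\<lambda>n. card (blocks_of n (markov_tree_shift A :: ('d, 'k) labeled_tree set))"
  have pos: "?B n > 0" for n
  proof -
    have "card (rooted_blocks A n i :: ('d list \<Rightarrow> 'k) set) > 0" for i
    proof (induction n arbitrary: i)
      case (Suc n)
      have "successors A i \<noteq> {}" using essential_successor[OF assms(2,3)] by blast
      with Suc show ?case by (simp add: card_rooted_blocks_Suc sum_pos)
    qed (simp add: card_rooted_blocks_0)
    then show ?thesis by (simp add: card_blocks_of_markov_tree_shift[OF assms(2,3)] sum_pos)
  qed
  show "0 \<le> ln (real (?B n))" for n using pos[of n] by simp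
  show "ln (real (?B (Suc n))) \<le> ln (real CARD('k)) + real CARD('d) * ln (real (?B n))" for n
  proof -
    have "real (?B (Suc n)) \<le> real (CARD('k) * ?B n ^ CARD('d))"
      using card_blocks_of_Suc_le[OF assms(2,3)] by (rule of_nat_mono)
    then have "ln (real (?B (Suc n))) \<le> ln (real CARD('k) * real (?B n) ^ CARD('d))"
      using pos[of "Suc n"] by (subst ln_le_cancel_iff) auto
    then show ?thesis using pos[of n] by (simp add: ln_mult ln_realpow)
  qed
qed (use assms(1) in simp_all)

theorem proposition4p1:
  fixes A :: "nat ^ 'k ^ 'k"
    and T :: "('d::finite, 'k) labeled_tree set"
  assumes "CARD('d) \<ge> 2"
    and "binary_matrix A" and "A \<noteq> 0" and "essential_matrix A"
    and "T = markov_tree_shift A"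
  shows "(max_row_sum A = 1 \<longrightarrow> entropy T = 0) \<and>
    (max_row_sum A \<ge> 2 \<longrightarrow>
      entropy T \<ge> (real CARD('d) - 1) / real CARD('d) * ln (real (max_row_sum A)) \<and>
      (real CARD('d) - 1) / real CARD('d) * ln (real (max_row_sum A)) \<ge> 1 / 2 * ln 2)"
proof (intro conjI impI)
  let ?d = "real CARD('d)" and ?M = "max_row_sum A"
  {
    assume M: "?M = 1"
    have "(\<lambda>n. ln (real CARD('k)) / ?d ^ n) \<longlonglongrightarrow> 0"
      using assms(1) by (intro LIMSEQ_divide_realpow_zero) simp
    then have "entropy T = (?d - 1) / ?d * 0"
      using assms(1)
      by (intro entropy_eqI) (simp_all add: assms(5) card_blocks_of_deterministic[OF assms(2,4) M])
    then show "entropy T = 0" by simp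
  next
    assume M: "?M \<ge> 2"
    obtain c where c: "(\<lambda>n. ln (real (card (blocks_of n T))) / ?d ^ n) \<longlonglongrightarrow> c"
      using convergent_ln_card_blocks_of[OF assms(1,2,4)] by (auto simp: assms(5) convergent_def)
    have "ln (real ?M) \<le> ln (real (card (blocks_of n T))) / ?d ^ n" if "n \<ge> 1" for n
    proof -
      have "real (?M ^ (CARD('d) ^ n)) \<le> real (card (blocks_of n T))"
        using power_le_card_blocks_of[OF assms(2,4) that, where 'd = 'd]
        unfolding assms(5) by (rule of_nat_mono)
      moreover have "real (?M ^ (CARD('d) ^ n)) > 0" using M by simp
      ultimately have "ln (real (?M ^ (CARD('d) ^ n))) \<le> ln (real (card (blocks_of n T)))"
        by (intro ln_mono)
      moreover have "ln (real (?M ^ (CARD('d) ^ n))) = ?d ^ n * ln (real ?M)"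
        using M by (simp add: ln_realpow)
      ultimately show ?thesis using assms(1) by (simp add: pos_le_divide_eq mult.commute)
    qed
    then have "ln (real ?M) \<le> c" by (intro LIMSEQ_le_const[OF c]) blast
    then show "entropy T \<ge> (?d - 1) / ?d * ln (real ?M)"
      using assms(1) by (subst entropy_eqI[OF assms(1) c], intro mult_left_mono) auto
    have "1 / 2 \<le> (?d - 1) / ?d" using assms(1) by (simp add: field_simps)
    then show "(?d - 1) / ?d * ln (real ?M) \<ge> 1 / 2 * ln 2"
      using M assms(1) by (intro mult_mono) auto
  }
qed

end
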